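(* Let $\Phi$ be an $N$-function in $\Delta_2(0)\cap\nabla_2(0)$ and let $N$ be an infinite finitely generated normal subgroup of a finitely generated (discrete) group $G$. If $N$ is non-amenable and its centralizer $Z_G(N)$ in $G$ is infinite, then $\overline{H}^1(G,\ell^\Phi(G))=0$.
   Context: An $N$-function is a function $\Phi:\mathbb{R}\to\mathbb{R}$ of the form $\Phi(x)=\int_0^{|x|}\varphi(t)\,dt$, where $\varphi:[0,\infty)\to[0,\infty)$ is non-decreasing, right-continuous, $\varphi(0)=0$, $\varphi(t)>0$ for $t>0$, and $\lim_{t\to\infty}\varphi(t)=\infty$. $\Phi\in\Delta_2(0)$ means: there are $x_0>0$ and $K>2$ with $\Phi(2x)\le K\Phi(x)$ for $0\le x\le x_0$. $\Phi\in\nabla_2(0)$ means: there are $x_0>0$ and $c>1$ with $\Phi(x)\le\frac{1}{2c}\Phi(cx)$ for $0\le x\le x_0$. For a countable set $X$ and $f:X\to\mathbb{R}$ put $\rho_\Phi(f)=\sum_{x\in X}\Phi(f(x))$. The Orlicz space is $\ell^\Phi(X)=\{f:X\to\mathbb{R} : \rho_\Phi(af)<\infty \text{ for some } a>0\}$, equipped with the gauge norm $\|f\|_{(\Phi)}=\inf\{k>0 : \rho_\Phi(f/k)\le 1\}$. For a discrete group $G$, $\ell^\Phi(G)$ is a Banach $G$-module under the left regular representation $(\lambda_G(g)f)(x)=f(g^{-1}x)$. For a discrete group $G$ and a Banach $G$-module $V$ (a Banach space with a linear isometric representation $\pi$ of $G$): $Z^1(G,V)=\{b:G\to V : b(gh)=b(g)+\pi(g)b(h)\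 \forall g,h\in G\}$; $B^1(G,V)$ is the subspace of those $b$ for which there is $v\in V$ with $b(g)=\pi(g)v-v$ for all $g\in G$. Equip $Z^1(G,V)$ with the topology of uniform convergence on compact (i.e. finite) subsets of $G$, and let $\overline{B}^1(G,V)$ be the closure of $B^1(G,V)$; the reduced 1-cohomology is $\overline{H}^1(G,V)=Z^1(G,V)/\overline{B}^1(G,V)$. *)

theory Defs
  imports
    "HOL-Analysis.Analysis"
    "HOL-Library.Function_Algebras"
    "HOL-Algebra.Generated_Groups"
    "HOL-Algebra.Elementary_Groups"
begin

section \<open>N-functions\<close>

definition N_function :: "(real \<Rightarrow> real) \<Rightarrow> bool" where
  "N_function \<Phi> \<longleftrightarrow> (\<exists>\<phi> :: real \<Rightarrow> real.
      mono_on {0..} \<phi> \<and>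
      (\<forall>t\<ge>0. 0 \<le> \<phi> t) \<and>
      (\<forall>t\<ge>0. continuous (at_right t) \<phi>) \<and>
      \<phi> 0 = 0 \<and>
      (\<forall>t>0. 0 < \<phi> t) \<and>
      filterlim \<phi> at_top at_top \<and>
      (\<forall>x. \<Phi> x = integral {0..\<bar>x\<bar>} \<phi>))"

definition Delta2_zero :: "(real \<Rightarrow> real) \<Rightarrow> bool" where
  "Delta2_zero \<Phi> \<longleftrightarrow>
     (\<exists>x0>0. \<exists>K>2. \<forall>x. 0 \<le> x \<and> x \<le> x0 \<longrightarrow> \<Phi> (2 * x) \<le> K * \<Phi> x)"

definition Nabla2_zero :: "(real \<Rightarrow> real) \<Rightarrow> bool" where
  "Nabla2_zero \<Phi> \<longleftrightarrow>
     (\<exists>x0>0. \<exists>c>1. \<forall>x. 0 \<le> x \<and> x \<le> x0 \<longrightarrow> \<Phi> x \<le> 1 / (2 * c) * \<Phi> (c * x))"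


section \<open>Orlicz sequence spaces\<close>

text \<open>A function \<open>X \<rightarrow> \<real>\<close> on a set \<open>X\<close> of some type is represented by the function on
  the whole type that agrees with it on \<open>X\<close> and vanishes elsewhere. Pointwise operations
  (theory Function_Algebras) respect this convention. The modular takes
  values in \<^typ>\<open>ennreal\<close>, so that \<open>\<rho> = \<infinity>\<close> is a genuine value.\<close>

definition modular :: "(real \<Rightarrow> real) \<Rightarrow> 'a set \<Rightarrow> ('a \<Rightarrow> real) \<Rightarrow> ennreal" where
  "modular \<Phi> X f = (\<Sum>\<^sub>\<infinity>x\<in>X. ennreal (\<Phi> (f x)))"

definition orlicz_space :: "(real \<Rightarrow> real) \<Rightarrow> 'a set \<Rightarrow> ('a \<Rightarrow> real) set" where
  "orlicz_space \<Phi> X =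
     {f. (\<forall>x. x \<notin> X \<longrightarrow> f x = 0) \<and> (\<exists>a>0. modular \<Phi> X (\<lambda>x. a * f x) < \<infinity>)}"

definition gauge_norm :: "(real \<Rightarrow> real) \<Rightarrow> 'a set \<Rightarrow> ('a \<Rightarrow> real) \<Rightarrow> real" where
  "gauge_norm \<Phi> X f = Inf {k. 0 < k \<and> modular \<Phi> X (\<lambda>x. f x / k) \<le> 1}"

definition left_regular ::
    "('a, 'm) monoid_scheme \<Rightarrow> 'a \<Rightarrow> ('a \<Rightarrow> real) \<Rightarrow> ('a \<Rightarrow> real)" where
  "left_regular G g f =
     (\<lambda>x. if x \<in> carrier G then f (inv\<^bsub>G\<^esub> g \<otimes>\<^bsub>G\<^esub> x) else 0)"


section \<open>Reduced first cohomology\<close>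

text \<open>A Banach \<open>G\<close>-module is given by its underlying set \<open>V\<close> (a subspace of an ambient
  additive group, here always a space of functions), its norm \<open>\<nu>\<close> on \<open>V\<close> and the action
  \<open>\<pi>\<close>. Maps \<open>G \<rightarrow> V\<close> vanish outside the carrier of \<open>G\<close>, as above.\<close>

definition cocycles ::
    "('g, 'm) monoid_scheme \<Rightarrow> 'v::ab_group_add set \<Rightarrow> ('g \<Rightarrow> 'v \<Rightarrow> 'v) \<Rightarrow> ('g \<Rightarrow> 'v) set" where
  "cocycles G V \<pi> =
     {b. (\<forall>g\<in>carrier G. b g \<in> V) \<and> (\<forall>g. g \<notin> carrier G \<longrightarrow> b g = 0) \<and>
         (\<forall>g\<in>carrier G. \<forall>h\<in>carrier G. b (g \<otimes>\<^bsub>G\<^esub> h) = b g + \<pi> g (b h))}"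

definition coboundaries ::
    "('g, 'm) monoid_scheme \<Rightarrow> 'v::ab_group_add set \<Rightarrow> ('g \<Rightarrow> 'v \<Rightarrow> 'v) \<Rightarrow> ('g \<Rightarrow> 'v) set" where
  "coboundaries G V \<pi> =
     {b \<in> cocycles G V \<pi>. \<exists>v\<in>V. \<forall>g\<in>carrier G. b g = \<pi> g v - v}"

text \<open>The topology of uniform convergence on finite subsets of \<open>G\<close>.\<close>

definition cocycle_topology ::
    "('g, 'm) monoid_scheme \<Rightarrow> 'v::ab_group_add set \<Rightarrow> ('v \<Rightarrow> real) \<Rightarrow> ('g \<Rightarrow> 'v \<Rightarrow> 'v)
       \<Rightarrow> ('g \<Rightarrow> 'v) topology" where
  "cocycle_topology G V \<nu> \<pi> = topology_generated_by
     {{c \<in> cocycles G V \<pi>. \<forall>g\<in>K. \<nu> (c g - b g) < \<epsilon>} | b K \<epsilon>.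
        b \<in> cocycles G V \<pi> \<and> finite K \<and> K \<subseteq> carrier G \<and> 0 < \<epsilon>}"

definition cocycle_group ::
    "('g, 'm) monoid_scheme \<Rightarrow> 'v::ab_group_add set \<Rightarrow> ('g \<Rightarrow> 'v \<Rightarrow> 'v) \<Rightarrow> ('g \<Rightarrow> 'v) monoid" where
  "cocycle_group G V \<pi> = \<lparr>carrier = cocycles G V \<pi>, mult = (\<lambda>b c. b + c), one = 0\<rparr>"

text \<open>The quotient is formed as an additive group; the scalar multiplication is irrelevant
  to whether it is zero.\<close>

definition reduced_cohomology1 ::
    "('g, 'm) monoid_scheme \<Rightarrow> 'v::ab_group_add set \<Rightarrow> ('v \<Rightarrow> real) \<Rightarrow> ('g \<Rightarrow> 'v \<Rightarrow> 'v)
       \<Rightarrow> ('g \<Rightarrow> 'v) set monoid" where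
  "reduced_cohomology1 G V \<nu> \<pi> =
     cocycle_group G V \<pi> Mod (cocycle_topology G V \<nu> \<pi> closure_of coboundaries G V \<pi>)"


section \<open>Groups\<close>

definition finitely_generated_group :: "('a, 'm) monoid_scheme \<Rightarrow> bool" where
  "finitely_generated_group G \<longleftrightarrow>
     (\<exists>S. finite S \<and> S \<subseteq> carrier G \<and> generate G S = carrier G)"

definition centralizer :: "('a, 'm) monoid_scheme \<Rightarrow> 'a set \<Rightarrow> 'a set" where
  "centralizer G N = {g \<in> carrier G. \<forall>n\<in>N. g \<otimes>\<^bsub>G\<^esub> n = n \<otimes>\<^bsub>G\<^esub> g}"

definition bounded_functions :: "'a set \<Rightarrow> ('a \<Rightarrow> real) set" where
  "bounded_functions X = {f. (\<forall>x. x \<notin> X \<longrightarrow> f x = 0) \<and> bounded (f ` X)}"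

text \<open>Amenability of a discrete group: existence of a left-invariant mean on the bounded
  functions.\<close>

definition amenable :: "('a, 'm) monoid_scheme \<Rightarrow> bool" where
  "amenable G \<longleftrightarrow> (\<exists>m :: ('a \<Rightarrow> real) \<Rightarrow> real.
      (\<forall>f\<in>bounded_functions (carrier G). \<forall>h\<in>bounded_functions (carrier G).
         m (f + h) = m f + m h) \<and>
      (\<forall>f\<in>bounded_functions (carrier G). \<forall>a. m (\<lambda>x. a * f x) = a * m f) \<and>
      (\<forall>f\<in>bounded_functions (carrier G). (\<forall>x. 0 \<le> f x) \<longrightarrow> 0 \<le> m f) \<and>
      m (indicator (carrier G)) = 1 \<and>
      (\<forall>f\<in>bounded_functions (carrier G). \<forall>g\<in>carrier G. m (left_regular G g f) = m f))"

end

theory Submission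
  imports Defs
begin

text \<open>Every cocycle \<open>b\<close> of \<open>G\<close> with values in \<open>\<ell>\<^sup>\<Phi>(G)\<close> turns out to be a coboundary, so that already the
  unreduced first cohomology vanishes. Write \<open>\<pi>\<close> for the left regular representation. An element
  \<open>z\<close> of the centralizer of \<open>N\<close> and an element \<open>n\<close> of \<open>N\<close> commute, and the cocycle identity turns
  this into
  \<open>(\<pi> n - 1) (b z) = (\<pi> z - 1) (b n)\<close>.

  The right-hand side is bounded in \<open>z\<close>. As \<open>N\<close> is non-amenable, \<open>\<pi>\<close> restricted to \<open>N\<close> has no almost
  invariant vectors: if unit vectors \<open>w\<^sub>k\<close> were almost invariant, then the densities \<open>\<Phi> \<circ> w\<^sub>k\<close> would
  be almost invariant in \<open>\<ell>\<^sup>1(G)\<close>, by convexity and the doubling condition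
  (\<open>oscillation_le\<close>, \<open>Delta2_on_sublevel\<close>), and would produce an invariant mean on \<open>N\<close>
  (\<open>Reiter_imp_amenable\<close>). Therefore \<open>b\<close> is bounded on the centralizer
  (\<open>cocycle_bounded_on_centralizer\<close>).

  The centralizer is infinite, so \<open>z\<close> may tend to infinity in it. Then \<open>\<pi> z (b n)\<close> tends to \<open>0\<close>
  pointwise, and a pointwise limit of the bounded family \<open>b z\<close> is, up to sign, a vector whose
  coboundary agrees with \<open>b\<close> on \<open>N\<close> (\<open>coboundary_on_normal_subgroup\<close>). The difference of \<open>b\<close> and this
  coboundary vanishes on the normal subgroup \<open>N\<close>, so that its values are \<open>N\<close>-invariant. Since \<open>N\<close> is
  infinite, they are zero (\<open>coboundary_extends_from_normal_subgroup\<close>).\<close>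

section \<open>Convex functions and Orlicz spaces\<close>

text \<open>The properties of an N-function on which the argument rests, apart from the growth condition
  at \<open>0\<close>.\<close>

locale young_function =
  fixes \<Phi> :: "real \<Rightarrow> real"
  assumes convex: "convex_on UNIV \<Phi>"
    and even: "\<Phi> (- x) = \<Phi> x"
    and zero [simp]: "\<Phi> 0 = 0"
    and pos: "x \<noteq> 0 \<Longrightarrow> 0 < \<Phi> x"

text \<open>Since \<open>\<phi>\<close> is non-decreasing, the line through \<open>(z, \<Phi> z)\<close> with slope
  \<open>sgn z * \<phi> \<bar>z\<bar>\<close> lies below the graph of \<open>\<Phi>\<close>. A function that has a supporting line at every
  point is convex.\<close>

lemma N_function_imp_young_function:
  assumes "N_function \<Phi>"
  shows "young_function \<Phi>"
proof -
  obtain \<phi> where mono: "mono_on {0..} \<phi>" and pos: "\<And>t. t > 0 \<Longrightarrow> 0 < \<phi> t"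
    and zero: "\<phi> 0 = 0" and \<Phi>: "\<And>x. \<Phi> x = integral {0..\<bar>x\<bar>} \<phi>"
    using assms unfolding N_function_def by blast
  have nonneg: "0 \<le> \<phi> t" if "t \<ge> 0" for t
    using pos[of t] zero that by (cases "t = 0") auto
  have int: "\<phi> integrable_on {a..b}" if "a \<ge> 0" for a b
    by (rule integrable_on_mono_on, rule mono_on_subset[OF mono]) (use that in auto)
  have split: "\<Phi> y = \<Phi> x + integral {x..y} \<phi>" if "0 \<le> x" "x \<le> y" for x y
    using Henstock_Kurzweil_Integration.integral_combine[of 0 x y \<phi>] int[of 0 y] that
    by (simp add: \<Phi>)
  have lower: "\<phi> x * (y - x) \<le> integral {x..y} \<phi>" if "0 \<le> x" "x \<le> y" for x y
  proof -
    have "integral {x..y} (\<lambda>_. \<phi> x) \<le> integral {x..y} \<phi>"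
      by (rule integral_le) (use that int in \<open>auto intro!: mono_onD[OF mono]\<close>)
    then show ?thesis
      using that by (simp add: mult.commute)
  qed
  have upper: "integral {x..y} \<phi> \<le> \<phi> y * (y - x)" if "0 \<le> x" "x \<le> y" for x y
  proof -
    have "integral {x..y} \<phi> \<le> integral {x..y} (\<lambda>_. \<phi> y)"
      by (rule integral_le) (use that int in \<open>auto intro!: mono_onD[OF mono]\<close>)
    then show ?thesis
      using that by (simp add: mult.commute)
  qed
  have abs: "\<Phi> x = \<Phi> \<bar>x\<bar>" for x
    by (simp add: \<Phi>)
  have tangent_nonneg: "\<Phi> z + \<phi> z * (y - z) \<le> \<Phi> y" if "0 \<le> y" "0 \<le> z" for y z
  proof (cases "z \<le> y")
    case True
    then show ?thesis using split[of z y] lower[of z y] that by simp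
  next
    case False
    then show ?thesis using split[of y z] upper[of y z] that by (simp add: algebra_simps)
  qed
  have tangent: "\<Phi> z + sgn z * \<phi> \<bar>z\<bar> * (y - z) \<le> \<Phi> y" for y z
  proof -
    have "sgn z * (y - z) \<le> \<bar>y\<bar> - \<bar>z\<bar>"
      by (auto simp: sgn_if abs_if)
    then have "\<phi> \<bar>z\<bar> * (sgn z * (y - z)) \<le> \<phi> \<bar>z\<bar> * (\<bar>y\<bar> - \<bar>z\<bar>)"
      by (intro mult_left_mono) (auto simp: nonneg)
    then show ?thesis
      using tangent_nonneg[of "\<bar>y\<bar>" "\<bar>z\<bar>"] abs[of y] abs[of z] by (simp add: mult_ac)
  qed
  show ?thesis
  proof
    show "convex_on UNIV \<Phi>"
    proof (rule convex_onI)
      fix t x y :: real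
      assume t: "t > 0" "t < 1"
      define z where "z = (1 - t) *\<^sub>R x + t *\<^sub>R y"
      define s where "s = sgn z * \<phi> \<bar>z\<bar>"
      have "(1 - t) * (\<Phi> z + s * (x - z)) + t * (\<Phi> z + s * (y - z)) \<le> (1 - t) * \<Phi> x + t * \<Phi> y"
        unfolding s_def by (intro add_mono mult_left_mono tangent) (use t in auto)
      moreover have "(1 - t) * (\<Phi> z + s * (x - z)) + t * (\<Phi> z + s * (y - z)) = \<Phi> z"
        by (simp add: z_def algebra_simps)
      ultimately show "\<Phi> ((1 - t) *\<^sub>R x + t *\<^sub>R y) \<le> (1 - t) * \<Phi> x + t * \<Phi> y"
        by (simp add: z_def)
    qed simp
  next
    fix x :: real
    show "\<Phi> (- x) = \<Phi> x" "\<Phi> 0 = 0" by (simp_all add: \<Phi>)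
    assume "x \<noteq> 0"
    moreover have "0 \<le> \<Phi> (\<bar>x\<bar> / 2)"
      unfolding \<Phi> by (rule Henstock_Kurzweil_Integration.integral_nonneg) (auto intro: int nonneg)
    ultimately have "0 < \<Phi> (\<bar>x\<bar> / 2) + \<phi> (\<bar>x\<bar> / 2) * (\<bar>x\<bar> / 2)"
      using pos[of "\<bar>x\<bar> / 2"] by (simp add: add_nonneg_pos)
    also have "\<dots> \<le> \<Phi> \<bar>x\<bar>"
      using tangent_nonneg[of "\<bar>x\<bar>" "\<bar>x\<bar> / 2"] by simp
    finally show "0 < \<Phi> x"
      using abs[of x] by simp
  qed
qed

lemma infsum_le_dominated:
  fixes f g :: "'i \<Rightarrow> real"
  assumes "(g has_sum c) A" and "\<And>x. x \<in> A \<Longrightarrow> 0 \<le> f x" and "\<And>x. x \<in> A \<Longrightarrow> f x \<le> g x"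
  shows "f summable_on A" and "infsum f A \<le> c"
proof -
  have g: "g summable_on A" "infsum g A = c"
    using has_sum_imp_summable[OF assms(1)] infsumI[OF assms(1)] .
  show f: "f summable_on A"
    by (rule summable_on_comparison_test[OF g(1)]) (use assms in auto)
  show "infsum f A \<le> c"
    using infsum_mono[OF f g(1) assms(3)] g(2) by simp
qed

context young_function
begin

lemma abs_eq [simp]: "\<Phi> \<bar>x\<bar> = \<Phi> x"
  by (simp add: abs_if even)

lemma nonneg [simp]: "0 \<le> \<Phi> x"
  using pos[of x] by (cases "x = 0") auto

lemma convexD:
  assumes "0 \<le> t" "t \<le> 1"
  shows "\<Phi> ((1 - t) * x + t * y) \<le> (1 - t) * \<Phi> x + t * \<Phi> y"
  using convex_onD[OF convex assms, of x y] by simp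

lemma contract:
  assumes "0 \<le> t" "t \<le> 1"
  shows "\<Phi> (t * x) \<le> t * \<Phi> x"
  using convexD[OF assms, of 0 x] by simp

lemma mono:
  assumes "\<bar>x\<bar> \<le> \<bar>y\<bar>"
  shows "\<Phi> x \<le> \<Phi> y"
proof (cases "y = 0")
  case True
  then show ?thesis using assms by simp
next
  case False
  have "\<Phi> x = \<Phi> (\<bar>x\<bar> / \<bar>y\<bar> * \<bar>y\<bar>)"
    using False by simp
  also have "\<dots> \<le> \<bar>x\<bar> / \<bar>y\<bar> * \<Phi> \<bar>y\<bar>"
    by (rule contract) (use assms False in auto)
  also have "\<dots> \<le> 1 * \<Phi> \<bar>y\<bar>"
    by (rule mult_right_mono) (use assms False in auto)
  finally show ?thesis by simp
qed

lemma add_le: "\<Phi> (x + y) \<le> \<Phi> (2 * x) / 2 + \<Phi> (2 * y) / 2"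
  using convexD[of "1 / 2" "2 * x" "2 * y"] by simp

lemma diff_le: "\<Phi> (x - y) \<le> \<Phi> (2 * x) / 2 + \<Phi> (2 * y) / 2"
  using add_le[of x "- y"] even[of "2 * y"] by simp

lemma continuous: "isCont \<Phi> x"
  using convex_on_continuous[OF open_UNIV convex] by (simp add: continuous_on_eq_continuous_at)

text \<open>The oscillation of \<open>\<Phi>\<close> is estimated by writing \<open>x\<close> as the convex combination
  \<open>(1 - \<epsilon>) * y + \<epsilon> * (y + (x - y) / \<epsilon>)\<close>. It makes \<open>\<Phi> \<circ> f\<close> and \<open>\<Phi> \<circ> h\<close> close in \<open>\<ell>\<^sup>1\<close>
  when \<open>f\<close> and \<open>h\<close> are close in norm, provided that doubling \<open>f\<close> and \<open>h\<close> keeps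
  their modulars bounded.\<close>

lemma oscillation_le:
  assumes "0 < \<epsilon>" "\<epsilon> \<le> 1"
  shows "\<bar>\<Phi> x - \<Phi> y\<bar> \<le> \<epsilon> / 2 * (\<Phi> (2 * x) + \<Phi> (2 * y) + \<Phi> (2 * ((x - y) / \<epsilon>)))"
proof -
  have one_sided: "\<Phi> x - \<Phi> y \<le> \<epsilon> / 2 * (\<Phi> (2 * x) + \<Phi> (2 * y) + \<Phi> (2 * ((x - y) / \<epsilon>)))" for x y
  proof -
    have "\<Phi> x = \<Phi> ((1 - \<epsilon>) * y + \<epsilon> * (y + (x - y) / \<epsilon>))"
      using assms by (simp add: distrib_left left_diff_distrib)
    also have "\<dots> \<le> (1 - \<epsilon>) * \<Phi> y + \<epsilon> * \<Phi> (y + (x - y) / \<epsilon>)"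
      by (rule convexD) (use assms in auto)
    also have "\<dots> \<le> \<Phi> y + \<epsilon> * (\<Phi> (2 * x) / 2 + \<Phi> (2 * y) / 2 + \<Phi> (2 * ((x - y) / \<epsilon>)) / 2)"
    proof (rule add_mono)
      show "(1 - \<epsilon>) * \<Phi> y \<le> \<Phi> y"
        using mult_right_mono[of "1 - \<epsilon>" 1 "\<Phi> y"] assms by simp
      have "\<Phi> (y + (x - y) / \<epsilon>) \<le> \<Phi> (2 * x) / 2 + \<Phi> (2 * y) / 2 + \<Phi> (2 * ((x - y) / \<epsilon>)) / 2"
        using add_le[of y "(x - y) / \<epsilon>"] nonneg[of "2 * x"] by linarith
      then show "\<epsilon> * \<Phi> (y + (x - y) / \<epsilon>)
          \<le> \<epsilon> * (\<Phi> (2 * x) / 2 + \<Phi> (2 * y) / 2 + \<Phi> (2 * ((x - y) / \<epsilon>)) / 2)"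
        using assms by (intro mult_left_mono) auto
    qed
    finally show ?thesis by (simp add: algebra_simps)
  qed
  have "\<Phi> (2 * ((y - x) / \<epsilon>)) = \<Phi> (2 * ((x - y) / \<epsilon>))"
    using even[of "2 * ((x - y) / \<epsilon>)"] by (simp add: minus_divide_left)
  then show ?thesis
    using one_sided[of x y] one_sided[of y x] by (simp only: add.commute[of "\<Phi> (2 * y)"])
qed

lemma sublevel_bounded:
  obtains M where "M > 0" "\<And>x. \<Phi> x \<le> 1 \<Longrightarrow> \<bar>x\<bar> \<le> M"
proof
  show "1 + 1 / \<Phi> 1 > 0"
    using pos[of 1] by (simp add: add_pos_pos)
  fix x assume x: "\<Phi> x \<le> 1"
  show "\<bar>x\<bar> \<le> 1 + 1 / \<Phi> 1"
  proof (cases "\<bar>x\<bar> \<le> 1")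
    case True
    then show ?thesis using pos[of 1] by (simp add: add_increasing2)
  next
    case False
    have "\<Phi> 1 = \<Phi> (1 / \<bar>x\<bar> * \<bar>x\<bar>)"
      using False by simp
    also have "\<dots> \<le> 1 / \<bar>x\<bar> * \<Phi> \<bar>x\<bar>"
      by (rule contract) (use False in auto)
    also have "\<dots> \<le> 1 / \<bar>x\<bar>"
      using x False by (simp add: divide_right_mono)
    finally have "\<bar>x\<bar> \<le> 1 / \<Phi> 1"
      using False pos[of 1] by (simp add: field_simps)
    then show ?thesis by simp
  qed
qed

text \<open>The doubling condition near \<open>0\<close> propagates to every bounded interval, because there
  \<open>\<Phi> (2 * x)\<close> is bounded above, while \<open>\<Phi> x\<close> is bounded below away from \<open>0\<close>. Functions of modular
  at most \<open>1\<close> take values in such an interval.\<close>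

lemma Delta2_on_sublevel:
  assumes "Delta2_zero \<Phi>"
  obtains C where "C > 0" "\<And>x. \<Phi> x \<le> 1 \<Longrightarrow> \<Phi> (2 * x) \<le> C * \<Phi> x"
proof -
  obtain x0 K where x0: "x0 > 0" and K: "K > 2"
    and D: "\<And>x. 0 \<le> x \<Longrightarrow> x \<le> x0 \<Longrightarrow> \<Phi> (2 * x) \<le> K * \<Phi> x"
    using assms unfolding Delta2_zero_def by blast
  obtain M where M: "M > 0" "\<And>x. \<Phi> x \<le> 1 \<Longrightarrow> \<bar>x\<bar> \<le> M"
    using sublevel_bounded by blast
  define L where "L = \<Phi> (2 * M) / \<Phi> x0"
  have L: "L \<ge> 0" by (simp add: L_def)
  show thesis
  proof (rule that[of "K + L"])
    show "K + L > 0" using K L by simp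
    fix x assume x: "\<Phi> x \<le> 1"
    show "\<Phi> (2 * x) \<le> (K + L) * \<Phi> x"
    proof (cases "\<bar>x\<bar> \<le> x0")
      case True
      have "\<Phi> (2 * x) = \<Phi> (2 * \<bar>x\<bar>)"
        using abs_eq[of "2 * x"] by (simp add: abs_mult)
      also have "\<dots> \<le> K * \<Phi> x"
        using D[of "\<bar>x\<bar>"] True by simp
      also have "\<dots> \<le> (K + L) * \<Phi> x"
        using L by (intro mult_right_mono) auto
      finally show ?thesis .
    next
      case False
      have "\<Phi> (2 * x) \<le> \<Phi> (2 * M)"
        using M(2)[OF x] M(1) by (intro mono) (simp add: abs_mult)
      also have "\<dots> = L * \<Phi> x0"
        using pos[of x0] x0 unfolding L_def by simp
      also have "\<dots> \<le> L * \<Phi> x"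
        using False x0 L by (intro mult_left_mono mono) auto
      also have "\<dots> \<le> (K + L) * \<Phi> x"
        using K by (intro mult_right_mono) auto
      finally show ?thesis .
    qed
  qed
qed

lemma modular_finite_iff:
  "modular \<Phi> X f < \<infinity> \<longleftrightarrow> (\<lambda>x. \<Phi> (f x)) summable_on X"
proof
  have sum_le: "ennreal (\<Sum>x\<in>F. \<Phi> (f x)) \<le> modular \<Phi> X f" if "finite F" "F \<subseteq> X" for F
  proof -
    have "(\<Sum>x\<in>F. ennreal (\<Phi> (f x))) \<le> modular \<Phi> X f"
      unfolding modular_def
      by (subst nonneg_infsum_complete) (use that in \<open>auto simp del: sum_ennreal intro: SUP_upper\<close>)
    then show ?thesis by simp
  qed
  assume fin: "modular \<Phi> X f < \<infinity>"
  show "(\<lambda>x. \<Phi> (f x)) summable_on X"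
  proof (rule nonneg_bdd_above_summable_on)
    show "bdd_above (sum (\<lambda>x. \<Phi> (f x)) ` {F. F \<subseteq> X \<and> finite F})"
    proof (rule bdd_aboveI2)
      fix F assume "F \<in> {F. F \<subseteq> X \<and> finite F}"
      then show "(\<Sum>x\<in>F. \<Phi> (f x)) \<le> enn2real (modular \<Phi> X f)"
        using enn2real_mono[OF sum_le, of F] fin by (simp add: sum_nonneg)
    qed
  qed simp
next
  assume "(\<lambda>x. \<Phi> (f x)) summable_on X"
  from infsum_nonneg_is_SUPREMUM_ennreal[OF this]
  have "modular \<Phi> X f = ennreal (\<Sum>\<^sub>\<infinity>x\<in>X. \<Phi> (f x))"
    unfolding modular_def by (subst nonneg_infsum_complete) (simp_all add: sum_ennreal)
  then show "modular \<Phi> X f < \<infinity>" by simp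
qed

lemma orlicz_space_iff:
  "f \<in> orlicz_space \<Phi> X \<longleftrightarrow>
     (\<forall>x. x \<notin> X \<longrightarrow> f x = 0) \<and> (\<exists>a>0. (\<lambda>x. \<Phi> (a * f x)) summable_on X)"
  unfolding orlicz_space_def mem_Collect_eq modular_finite_iff ..

text \<open>By convexity, dividing a function by \<open>t \<ge> 1\<close> divides its modular at least by \<open>t\<close>. The
  radii obtained here stand in for the gauge norm in the estimates below.\<close>

lemma orlicz_space_modular_le_1:
  assumes "f \<in> orlicz_space \<Phi> X"
  obtains R where "R > 0"
    "\<And>r. r \<ge> R \<Longrightarrow> (\<lambda>x. \<Phi> (f x / r)) summable_on X \<and> (\<Sum>\<^sub>\<infinity>x\<in>X. \<Phi> (f x / r)) \<le> 1"
proof -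
  obtain a where a: "a > 0" "(\<lambda>x. \<Phi> (a * f x)) summable_on X"
    using assms by (auto simp: orlicz_space_iff)
  define s where "s = (\<Sum>\<^sub>\<infinity>x\<in>X. \<Phi> (a * f x))"
  have s: "((\<lambda>x. \<Phi> (a * f x)) has_sum s) X"
    using a(2) by (simp add: s_def)
  show thesis
  proof (rule that[of "max 1 s / a"])
    show "max 1 s / a > 0" using a by simp
    fix r assume "r \<ge> max 1 s / a"
    then have r: "r * a \<ge> 1" "r * a \<ge> s"
      using a(1) by (simp_all add: divide_le_eq)
    then have r_pos: "r > 0"
      using a(1) mult_nonpos_nonneg[of r a] by linarith
    have le: "\<Phi> (f x / r) \<le> 1 / (r * a) * \<Phi> (a * f x)" for x
      using contract[of "1 / (r * a)" "a * f x"] r(1) r_pos a(1) by simp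
    note dom = infsum_le_dominated[OF has_sum_cmult_right[OF s], of "\<lambda>x. \<Phi> (f x / r)", OF nonneg le]
    have "1 / (r * a) * s \<le> 1"
      using r r_pos a(1) by (simp add: divide_le_eq)
    then show "(\<lambda>x. \<Phi> (f x / r)) summable_on X \<and> (\<Sum>\<^sub>\<infinity>x\<in>X. \<Phi> (f x / r)) \<le> 1"
      using dom by auto
  qed
qed

text \<open>Elements of the Orlicz space tend to \<open>0\<close> at infinity. Therefore their translates by
  group elements tending to infinity converge pointwise to \<open>0\<close>, and no nonzero element is invariant
  under an infinite subgroup.\<close>

lemma orlicz_space_finite_superlevel:
  assumes "f \<in> orlicz_space \<Phi> X" and "0 < \<epsilon>"
  shows "finite {x. \<epsilon> \<le> \<bar>f x\<bar>}"
proof (rule ccontr)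
  obtain a where a: "a > 0" and sum: "(\<lambda>x. \<Phi> (a * f x)) summable_on X"
    using assms by (auto simp: orlicz_space_iff)
  define s where "s = (\<Sum>\<^sub>\<infinity>x\<in>X. \<Phi> (a * f x))"
  define \<delta> where "\<delta> = \<Phi> (a * \<epsilon>)"
  have \<delta>: "\<delta> > 0" using a assms by (simp add: \<delta>_def pos)
  obtain n where n: "s / \<delta> < real n" using reals_Archimedean2 by blast
  assume "infinite {x. \<epsilon> \<le> \<bar>f x\<bar>}"
  then obtain F where F: "finite F" "card F = n" "F \<subseteq> {x. \<epsilon> \<le> \<bar>f x\<bar>}"
    using infinite_arbitrarily_large by blast
  have FX: "F \<subseteq> X"
    using F(3) assms by (force simp: orlicz_space_iff)
  have "real n * \<delta> = (\<Sum>x\<in>F. \<delta>)" using F by simp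
  also have "\<dots> \<le> (\<Sum>x\<in>F. \<Phi> (a * f x))"
    unfolding \<delta>_def using F(3) a assms(2) by (intro sum_mono mono) (auto simp: abs_mult)
  also have "\<dots> \<le> s"
    unfolding s_def by (rule finite_sum_le_infsum[OF sum F(1) FX]) simp
  finally show False using n \<delta> by (simp add: field_simps)
qed

lemma orlicz_space_diff:
  assumes "f \<in> orlicz_space \<Phi> X" and "h \<in> orlicz_space \<Phi> X"
  shows "(\<lambda>x. f x - h x) \<in> orlicz_space \<Phi> X"
proof -
  obtain R where R: "R > 0" "\<And>r. r \<ge> R \<Longrightarrow> (\<lambda>x. \<Phi> (f x / r)) summable_on X"
    using orlicz_space_modular_le_1[OF assms(1)] by metis
  obtain S where S: "S > 0" "\<And>r. r \<ge> S \<Longrightarrow> (\<lambda>x. \<Phi> (h x / r)) summable_on X"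
    using orlicz_space_modular_le_1[OF assms(2)] by metis
  define r where "r = max R S"
  have "(\<lambda>x. (\<Phi> (f x / r) + \<Phi> (h x / r)) * (1 / 2)) summable_on X"
    by (intro summable_on_cmult_left summable_on_add R S) (auto simp: r_def)
  moreover have "\<Phi> (1 / (2 * r) * (f x - h x)) \<le> (\<Phi> (f x / r) + \<Phi> (h x / r)) * (1 / 2)" for x
    using diff_le[of "f x / (2 * r)" "h x / (2 * r)"] by (simp add: diff_divide_distrib)
  ultimately have "(\<lambda>x. \<Phi> (1 / (2 * r) * (f x - h x))) summable_on X"
    by (rule summable_on_comparison_test) simp
  moreover have "1 / (2 * r) > 0" using R by (simp add: r_def)
  moreover have "\<forall>x. x \<notin> X \<longrightarrow> f x - h x = 0"
    using assms by (simp add: orlicz_space_iff)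
  ultimately show ?thesis
    unfolding orlicz_space_iff by blast
qed

end

section \<open>Almost invariant densities and amenability\<close>

text \<open>Tychonoff's theorem, in the form of a filter that refines \<open>sequentially\<close>. The
  index type may be uncountable, so that a subsequence would not do: in the construction of an
  invariant mean the indices are the functions on a group.\<close>

lemma bounded_sequence_subnet:
  fixes M :: "nat \<Rightarrow> 'i \<Rightarrow> real"
  assumes bound: "\<And>k i. \<bar>M k i\<bar> \<le> B i"
  obtains m F where "F \<noteq> bot" "F \<le> sequentially" "\<And>i. ((\<lambda>k. M k i) \<longlongrightarrow> m i) F"
proof -
  let ?K = "Pi\<^sub>E UNIV (\<lambda>i. {- B i..B i})"
  have "compactin (product_topology (\<lambda>i. euclidean) UNIV) ?K"
    by (subst compactin_PiE) simp
  then have "compact ?K"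
    by (simp add: euclidean_product_topology)
  moreover have "\<forall>\<^sub>F \<mu> in filtermap M sequentially. \<mu> \<in> ?K"
    unfolding eventually_filtermap
  proof (intro always_eventually allI PiE_I)
    fix k i
    show "M k i \<in> {- B i..B i}" using bound[of k i] by (simp add: abs_le_iff minus_le_iff)
  qed simp
  ultimately obtain m where m: "inf (nhds m) (filtermap M sequentially) \<noteq> bot"
    unfolding compact_filter by (metis filtermap_bot_iff sequentially_bot)
  define F where "F = inf sequentially (filtercomap M (nhds m))"
  have "filterlim M (nhds m) F"
    unfolding F_def filterlim_def
    by (metis filtermap_filtercomap filtermap_mono inf.cobounded2 order.trans)
  then have lim: "((\<lambda>k. M k i) \<longlongrightarrow> m i) F" for i
    using continuous_on_product_coordinates[of i, unfolded continuous_on_def, THEN bspec, of m]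
    by (auto intro: tendsto_compose[of "\<lambda>\<mu>. \<mu> i"])
  have "F \<noteq> bot"
  proof
    assume "F = bot"
    then have "eventually (\<lambda>_. False) F" by simp
    then obtain Q R where Q: "eventually Q sequentially" and "eventually R (filtercomap M (nhds m))"
      and QR: "\<And>k. Q k \<Longrightarrow> R k \<Longrightarrow> False"
      unfolding F_def eventually_inf by blast
    then obtain R' where R': "eventually R' (nhds m)" "\<And>k. R' (M k) \<Longrightarrow> R k"
      unfolding eventually_filtercomap by blast
    have "eventually (\<lambda>\<mu>. \<not> R' \<mu>) (filtermap M sequentially)"
      unfolding eventually_filtermap using Q by eventually_elim (use R' QR in blast)
    with R'(1) have "eventually (\<lambda>_. False) (inf (nhds m) (filtermap M sequentially))"
      unfolding eventually_inf by blast
    with m show False by (simp add: trivial_limit_def)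
  qed
  then show thesis
    using that[OF _ _ lim] by (simp add: F_def)
qed

lemma infsum_diff_real:
  fixes f g :: "'i \<Rightarrow> real"
  assumes "f summable_on A" and "g summable_on A"
  shows "(\<lambda>x. f x - g x) summable_on A"
    and "infsum (\<lambda>x. f x - g x) A = infsum f A - infsum g A"
proof -
  have g: "(\<lambda>x. - g x) summable_on A"
    by (rule summable_on_uminus[THEN iffD2]) (rule assms(2))
  show "(\<lambda>x. f x - g x) summable_on A"
    using summable_on_add[OF assms(1) g] by simp
  show "infsum (\<lambda>x. f x - g x) A = infsum f A - infsum g A"
    using infsum_add[OF assms(1) g] by (simp add: infsum_uminus)
qed

lemma (in group) translation_bij:
  "g \<in> carrier G \<Longrightarrow> bij_betw (\<lambda>x. g \<otimes> x) (carrier G) (carrier G)"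
  by (rule bij_betw_byWitness[of _ "\<lambda>x. inv g \<otimes> x"]) (auto simp: m_assoc[symmetric])

text \<open>Reiter's condition for the action of \<open>N\<close> on \<open>G\<close> by left translation. Choosing
  representatives of the right cosets of \<open>N\<close> gives an equivariant map \<open>\<nu>: G \<rightarrow> N\<close>. The means
  \<open>f \<mapsto> \<Sum>x. P k x * f (\<nu> x)\<close> are asymptotically invariant, and a limit of them along a filter
  as above is an invariant mean on \<open>N\<close>.\<close>

lemma Reiter_imp_amenable:
  fixes G :: "('a, 'm) monoid_scheme" (structure) and P :: "nat \<Rightarrow> 'a \<Rightarrow> real"
  assumes "group G" and "subgroup N G"
    and nonneg: "\<And>k x. 0 \<le> P k x"
    and summable: "\<And>k. P k summable_on carrier G"
    and total: "\<And>k. infsum (P k) (carrier G) = 1"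
    and invariant: "\<And>n. n \<in> N \<Longrightarrow> (\<lambda>k. \<Sum>\<^sub>\<infinity>x\<in>carrier G. \<bar>P k (n \<otimes> x) - P k x\<bar>) \<longlonglongrightarrow> 0"
  shows "amenable (G\<lparr>carrier := N\<rparr>)"
proof -
  interpret group G by fact
  interpret N: subgroup N G by fact
  define \<nu> where "\<nu> x = x \<otimes> inv (SOME y. y \<in> N #> x)" for x
  have rep: "(SOME y. y \<in> N #> x) \<in> N #> x" if "x \<in> carrier G" for x
    using rcos_self[OF that \<open>subgroup N G\<close>] by (rule someI)
  have repG: "(SOME y. y \<in> N #> x) \<in> carrier G" if "x \<in> carrier G" for x
    using rep[OF that] N.elemrcos_carrier[OF \<open>group G\<close> that] by blast
  have \<nu>_in: "\<nu> x \<in> N" if "x \<in> carrier G" for x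
  proof -
    have "inv ((SOME y. y \<in> N #> x) \<otimes> inv x) \<in> N"
      using N.rcos_module_imp[OF \<open>group G\<close> that rep[OF that]] by (rule N.m_inv_closed)
    then show ?thesis
      using repG[OF that] that by (simp add: \<nu>_def inv_mult_group)
  qed
  have \<nu>_mult: "\<nu> (n \<otimes> x) = n \<otimes> \<nu> x" if "n \<in> N" "x \<in> carrier G" for n x
  proof -
    have "N #> x = N #> (n \<otimes> x)"
      using that by (intro repr_independence rcosI \<open>subgroup N G\<close>) (auto simp: N.subset)
    then show ?thesis
      using that repG[OF that(2)] N.mem_carrier by (simp add: \<nu>_def m_assoc)
  qed
  have "\<forall>f\<in>bounded_functions N. \<exists>B. \<forall>x. \<bar>f x\<bar> \<le> B"
  proof
    fix f :: "'a \<Rightarrow> real" assume f: "f \<in> bounded_functions N"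
    then obtain B where "\<forall>x\<in>N. \<bar>f x\<bar> \<le> B"
      by (auto simp: bounded_functions_def bounded_iff)
    then have "\<bar>f x\<bar> \<le> \<bar>B\<bar>" for x
      using f by (cases "x \<in> N") (force simp: bounded_functions_def)+
    then show "\<exists>B. \<forall>x. \<bar>f x\<bar> \<le> B" by blast
  qed
  then obtain B where B: "\<And>f x. f \<in> bounded_functions N \<Longrightarrow> \<bar>f x\<bar> \<le> B f"
    by metis
  \<comment> \<open>The value \<open>0\<close> off the bounded functions keeps \<open>M k f\<close> bounded in \<open>k\<close> for every \<open>f\<close>.\<close>
  define M where "M k f = (if f \<in> bounded_functions N
    then \<Sum>\<^sub>\<infinity>x\<in>carrier G. P k x * f (\<nu> x) else 0)" for k f
  have sum_mult: "(\<lambda>x. P k x * f (h x)) summable_on carrier G"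
    if "f \<in> bounded_functions N" for k f h
  proof -
    have "(\<lambda>x. norm (P k x * f (h x))) summable_on carrier G"
    proof (rule summable_on_comparison_test[OF summable_on_cmult_right[OF summable[of k], of "B f"]])
      fix x
      show "norm (P k x * f (h x)) \<le> B f * P k x"
        using mult_left_mono[OF B[OF that, of "h x"] nonneg[of k x]] nonneg[of k x]
        by (simp add: abs_mult mult.commute)
    qed simp
    then show ?thesis by (rule abs_summable_summable)
  qed
  have M_bound: "\<bar>M k f\<bar> \<le> (if f \<in> bounded_functions N then B f else 0)" for k f
  proof (cases "f \<in> bounded_functions N")
    case True
    have "infsum (\<lambda>x. P k x * f (\<nu> x)) (carrier G) \<le> infsum (\<lambda>x. B f * P k x) (carrier G)"
    proof (intro infsum_mono sum_mult summable_on_cmult_right summable True)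
      fix x
      have "f (\<nu> x) \<le> B f" using B[OF True, of "\<nu> x"] by linarith
      from mult_left_mono[OF this nonneg] show "P k x * f (\<nu> x) \<le> B f * P k x"
        by (simp add: mult.commute)
    qed
    moreover have "infsum (\<lambda>x. - B f * P k x) (carrier G) \<le> infsum (\<lambda>x. P k x * f (\<nu> x)) (carrier G)"
    proof (intro infsum_mono sum_mult summable_on_cmult_right summable True)
      fix x
      have "- B f \<le> f (\<nu> x)" using B[OF True, of "\<nu> x"] by linarith
      from mult_left_mono[OF this nonneg] show "- B f * P k x \<le> P k x * f (\<nu> x)"
        by (simp add: mult.commute)
    qed
    ultimately show ?thesis
      using True by (simp only: infsum_cmult_right' total M_def) (simp add: abs_le_iff)
  qed (simp add: M_def)
  obtain m F where F: "F \<noteq> bot" "F \<le> sequentially" and lim: "\<And>f. ((\<lambda>k. M k f) \<longlongrightarrow> m f) F"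
    using bounded_sequence_subnet[of M, OF M_bound] by blast
  have m_eqI: "m f = c" if "((\<lambda>k. M k f) \<longlongrightarrow> c) F" for f c
    using tendsto_unique[OF F(1) lim that] .
  have add: "m (f + h) = m f + m h" if "f \<in> bounded_functions N" "h \<in> bounded_functions N" for f h
  proof (rule m_eqI)
    have fh: "f + h \<in> bounded_functions N"
      using that by (auto simp: bounded_functions_def bounded_plus_comp)
    have "M k (f + h) = M k f + M k h" for k
      using that fh by (simp add: M_def distrib_left infsum_add sum_mult)
    then show "((\<lambda>k. M k (f + h)) \<longlongrightarrow> m f + m h) F"
      using tendsto_add[OF lim[of f] lim[of h]] by simp
  qed
  have scale: "m (\<lambda>x. a * f x) = a * m f" if "f \<in> bounded_functions N" for f a
  proof (rule m_eqI)
    have "(\<lambda>x. a * f x) \<in> bounded_functions N"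
      using that bounded_scaleR_comp[of f N a] by (auto simp: bounded_functions_def)
    then have "M k (\<lambda>x. a * f x) = a * M k f" for k
      using that by (simp add: M_def mult.left_commute infsum_cmult_right')
    then show "((\<lambda>k. M k (\<lambda>x. a * f x)) \<longlongrightarrow> a * m f) F"
      using tendsto_mult_left[OF lim[of f], of a] by simp
  qed
  have pos: "0 \<le> m f" if "f \<in> bounded_functions N" "\<forall>x. 0 \<le> f x" for f
  proof (rule tendsto_lowerbound[OF lim _ F(1)])
    show "\<forall>\<^sub>F k in F. 0 \<le> M k f"
      using that nonneg by (intro always_eventually) (auto simp: M_def intro!: infsum_nonneg)
  qed
  have one: "m (indicator N) = 1"
  proof (rule m_eqI)
    have "bounded ((indicator N :: 'a \<Rightarrow> real) ` N)"
      by (rule boundedI[of _ 1]) (auto simp: indicator_def)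
    then have "(indicator N :: 'a \<Rightarrow> real) \<in> bounded_functions N"
      by (auto simp: bounded_functions_def)
    then have "M k (indicator N) = 1" for k
      using \<nu>_in total[of k] by (simp add: M_def cong: infsum_cong)
    then show "((\<lambda>k. M k (indicator N)) \<longlongrightarrow> 1) F" by simp
  qed
  have inv: "m (left_regular (G\<lparr>carrier := N\<rparr>) n f) = m f"
    if f: "f \<in> bounded_functions N" and n: "n \<in> N" for f n
  proof -
    define f' where "f' = left_regular (G\<lparr>carrier := N\<rparr>) n f"
    have f'_eq: "f' x = (if x \<in> N then f (inv n \<otimes> x) else 0)" for x
      using n \<open>subgroup N G\<close> by (simp add: f'_def left_regular_def)
    have f': "f' \<in> bounded_functions N"
      using B[OF f] by (auto simp: f'_eq bounded_functions_def intro!: boundedI[of _ "B f"])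
    have bij: "bij_betw (\<lambda>x. n \<otimes> x) (carrier G) (carrier G)"
      by (rule translation_bij[OF N.mem_carrier[OF n]])
    have shift: "M k f' = (\<Sum>\<^sub>\<infinity>x\<in>carrier G. P k (n \<otimes> x) * f (\<nu> x))" for k
    proof -
      have "M k f' = (\<Sum>\<^sub>\<infinity>x\<in>carrier G. P k (n \<otimes> x) * f' (\<nu> (n \<otimes> x)))"
        using infsum_reindex_bij_betw[OF bij, of "\<lambda>x. P k x * f' (\<nu> x)"] f' by (simp add: M_def)
      also have "\<dots> = (\<Sum>\<^sub>\<infinity>x\<in>carrier G. P k (n \<otimes> x) * f (\<nu> x))"
      proof (rule infsum_cong)
        fix x assume x: "x \<in> carrier G"
        then show "P k (n \<otimes> x) * f' (\<nu> (n \<otimes> x)) = P k (n \<otimes> x) * f (\<nu> x)"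
          using n \<nu>_in[OF x] N.mem_carrier by (simp add: f'_eq \<nu>_mult m_assoc[symmetric])
      qed
      finally show ?thesis .
    qed
    have summable': "(\<lambda>x. P k (n \<otimes> x)) summable_on carrier G" for k
      using summable_on_reindex_bij_betw[OF bij, of "P k"] summable by simp
    have sum_shift: "(\<lambda>x. P k (n \<otimes> x) * f (\<nu> x)) summable_on carrier G" for k
    proof -
      have "(\<lambda>x. P k (n \<otimes> x) * f (\<nu> (inv n \<otimes> (n \<otimes> x)))) summable_on carrier G"
        using summable_on_reindex_bij_betw[OF bij, of "\<lambda>x. P k x * f (\<nu> (inv n \<otimes> x))"]
          sum_mult[OF f, of k "\<lambda>x. \<nu> (inv n \<otimes> x)"] by simp
      then show ?thesis
        by (rule summable_on_cong[THEN iffD1, rotated])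
          (use n in \<open>simp add: m_assoc[symmetric]\<close>)
    qed
    have diff_bound: "\<bar>M k f' - M k f\<bar> \<le> B f * (\<Sum>\<^sub>\<infinity>x\<in>carrier G. \<bar>P k (n \<otimes> x) - P k x\<bar>)" for k
    proof -
      have eq: "M k f' - M k f = (\<Sum>\<^sub>\<infinity>x\<in>carrier G. (P k (n \<otimes> x) - P k x) * f (\<nu> x))"
        unfolding shift using f infsum_diff_real(2)[OF sum_shift[of k] sum_mult[OF f, of k \<nu>]]
        by (simp add: M_def left_diff_distrib)
      have abs_sum: "(\<lambda>x. norm (P k (n \<otimes> x) - P k x)) summable_on carrier G"
        using infsum_diff_real(1)[OF summable' summable]
        by (rule summable_on_iff_abs_summable_on_real[THEN iffD1])
      have bd: "norm ((P k (n \<otimes> x) - P k x) * f (\<nu> x)) \<le> B f * norm (P k (n \<otimes> x) - P k x)" for x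
        using mult_right_mono[OF B[OF f, of "\<nu> x"], of "norm (P k (n \<otimes> x) - P k x)"]
        by (simp add: abs_mult mult.commute)
      have abs_sum2: "(\<lambda>x. norm ((P k (n \<otimes> x) - P k x) * f (\<nu> x))) summable_on carrier G"
        by (rule summable_on_comparison_test[OF summable_on_cmult_right[OF abs_sum, of "B f"] bd]) simp
      show ?thesis
        unfolding eq
        using order.trans[OF norm_infsum_bound[OF abs_sum2]
          infsum_mono[OF abs_sum2 summable_on_cmult_right[OF abs_sum, of "B f"] bd]]
        by (simp only: infsum_cmult_right' real_norm_def)
    qed
    have "((\<lambda>k. M k f' - M k f) \<longlonglongrightarrow> 0)"
    proof (rule Lim_null_comparison)
      show "\<forall>\<^sub>F k in sequentially. norm (M k f' - M k f)
          \<le> B f * (\<Sum>\<^sub>\<infinity>x\<in>carrier G. \<bar>P k (n \<otimes> x) - P k x\<bar>)"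
        using diff_bound by simp
      show "(\<lambda>k. B f * (\<Sum>\<^sub>\<infinity>x\<in>carrier G. \<bar>P k (n \<otimes> x) - P k x\<bar>)) \<longlonglongrightarrow> 0"
        using tendsto_mult_left[OF invariant[OF n], of "B f"] by simp
    qed
    from tendsto_add[OF filterlim_mono[OF this order_refl F(2)] lim[of f]]
    have "((\<lambda>k. M k f') \<longlongrightarrow> m f) F" by simp
    then show ?thesis
      unfolding f'_def by (rule m_eqI)
  qed
  show ?thesis
    unfolding amenable_def using add scale pos one inv by (intro exI[of _ m]) auto
qed

section \<open>Cocycles in the regular representation\<close>

locale orlicz_module = young_function \<Phi> + group G
  for \<Phi> :: "real \<Rightarrow> real" and G :: "('a, 'm) monoid_scheme" (structure)
begin

abbreviation V :: "('a \<Rightarrow> real) set" where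
  "V \<equiv> orlicz_space \<Phi> (carrier G)"

abbreviation Z1 :: "('a \<Rightarrow> 'a \<Rightarrow> real) set" where
  "Z1 \<equiv> cocycles G V (left_regular G)"

lemma left_regular_closed:
  assumes "g \<in> carrier G" and "f \<in> V"
  shows "left_regular G g f \<in> V"
proof -
  obtain a where a: "a > 0" "(\<lambda>x. \<Phi> (a * f x)) summable_on carrier G"
    using assms by (auto simp: orlicz_space_iff)
  have "(\<lambda>x. \<Phi> (a * f (inv g \<otimes> x))) summable_on carrier G"
    using summable_on_reindex_bij_betw[OF translation_bij[of "inv g"], of "\<lambda>x. \<Phi> (a * f x)"] a(2) assms(1)
    by simp
  then have "(\<lambda>x. \<Phi> (a * left_regular G g f x)) summable_on carrier G"
    by (rule summable_on_cong[THEN iffD1, rotated]) (simp add: left_regular_def)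
  with a(1) show ?thesis
    unfolding orlicz_space_iff by (auto simp: left_regular_def)
qed

lemma cocycle_in_space: "b \<in> Z1 \<Longrightarrow> g \<in> carrier G \<Longrightarrow> b g \<in> V"
  by (simp add: cocycles_def)

lemma cocycle_mult_apply:
  assumes "b \<in> Z1" "g \<in> carrier G" "h \<in> carrier G" "x \<in> carrier G"
  shows "b (g \<otimes> h) x = b g x + b h (inv g \<otimes> x)"
  using assms by (simp add: cocycles_def left_regular_def)

text \<open>Expanding \<open>b (z \<otimes> n) = b (n \<otimes> z)\<close> in both orders gives
  \<open>(\<pi> n - 1) (b z) = (\<pi> z - 1) (b n)\<close>: commuting elements control each other's cocycle values.\<close>

lemma cocycle_commuting:
  assumes "b \<in> Z1" "z \<in> carrier G" "n \<in> carrier G" "z \<otimes> n = n \<otimes> z" "x \<in> carrier G"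
  shows "b z (inv n \<otimes> x) - b z x = b n (inv z \<otimes> x) - b n x"
  using cocycle_mult_apply[OF assms(1,2,3,5)] cocycle_mult_apply[OF assms(1,3,2,5)] assms(4) by simp

text \<open>If \<open>b\<close> were unbounded on the centralizer, normalizing the values \<open>b (z k)\<close> by their size
  \<open>r k \<rightarrow> \<infinity>\<close> would give vectors \<open>w k\<close> with \<open>\<pi> (inv n) (w k) - w k = (\<pi> (z k) - 1) (b (inv n)) / r k\<close>
  for every \<open>n\<close> in \<open>N\<close>. The right-hand side tends to \<open>0\<close>, so the \<open>w k\<close> are almost invariant, and
  the densities \<open>\<Phi> \<circ> w k\<close>, scaled to total mass \<open>1\<close>, satisfy Reiter's condition. The doubling
  condition enters twice: it keeps the total mass of \<open>\<Phi> \<circ> w k\<close> away from \<open>0\<close>, and it turns almost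
  invariance of \<open>w k\<close> into almost invariance of \<open>\<Phi> \<circ> w k\<close>.\<close>

lemma cocycle_bounded_on_centralizer:
  assumes Delta2: "Delta2_zero \<Phi>" and N: "subgroup N G" "\<not> amenable (G\<lparr>carrier := N\<rparr>)"
    and b: "b \<in> Z1"
  obtains r where "r > 0"
    "\<And>z. z \<in> centralizer G N \<Longrightarrow>
      (\<lambda>x. \<Phi> (b z x / r)) summable_on carrier G \<and> (\<Sum>\<^sub>\<infinity>x\<in>carrier G. \<Phi> (b z x / r)) \<le> 1"
proof -
  define good where "good z r \<longleftrightarrow>
    (\<lambda>x. \<Phi> (b z x / r)) summable_on carrier G \<and> (\<Sum>\<^sub>\<infinity>x\<in>carrier G. \<Phi> (b z x / r)) \<le> 1" for z r
  have "\<exists>r>0. \<forall>z\<in>centralizer G N. good z r"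
  proof (rule ccontr)
    assume unbounded: "\<not> ?thesis"
    have centralizer: "z \<in> carrier G" "\<And>n. n \<in> N \<Longrightarrow> z \<otimes> n = n \<otimes> z"
      if "z \<in> centralizer G N" for z
      using that by (auto simp: centralizer_def)
    (* A radius within a factor 2 of the gauge norm of b z is found by doubling k + 1 until
       the modular first drops to 1 or below. *)
    have "\<exists>z r. z \<in> centralizer G N \<and> real k + 1 \<le> r \<and> good z r \<and> \<not> good z (r / 2)" for k
    proof -
      obtain z where z: "z \<in> centralizer G N" "\<not> good z (real k + 1)"
        using unbounded by (metis add_nonneg_pos of_nat_0_le_iff zero_less_one)
      obtain R where R: "\<And>r. r \<ge> R \<Longrightarrow> good z r"
        using orlicz_space_modular_le_1[OF cocycle_in_space[OF b centralizer(1)[OF z(1)]]]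
        unfolding good_def by blast
      define s where "s j = (real k + 1) * 2 ^ j" for j :: nat
      have s_Suc: "s (Suc j) / 2 = s j" for j by (simp add: s_def)
      obtain j where "R \<le> s j"
      proof -
        obtain j :: nat where "R < 2 ^ j"
          using real_arch_pow[of 2 R] by auto
        moreover have "1 * 2 ^ j \<le> s j"
          unfolding s_def by (rule mult_right_mono) auto
        ultimately show thesis using that[of j] by simp
      qed
      then have "good z (s j)" by (rule R)
      define i where "i = (LEAST j. good z (s j))"
      have i: "good z (s i)" "\<And>j. j < i \<Longrightarrow> \<not> good z (s j)"
        unfolding i_def using \<open>good z (s j)\<close> by (auto intro: LeastI dest: not_less_Least)
      have "i \<noteq> 0"
        using i(1) z(2) by (intro notI) (simp add: s_def)
      then obtain l where l: "i = Suc l" by (cases i) auto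
      have "(real k + 1) * 1 \<le> s i"
        unfolding s_def by (rule mult_left_mono) auto
      then show ?thesis
        using z(1) i(1) i(2)[of l] l s_Suc[of l] by (intro exI[of _ z] exI[of _ "s i"]) simp
    qed
    then obtain z r where z: "\<And>k. z k \<in> centralizer G N" and r: "\<And>k. real k + 1 \<le> r k"
      and good: "\<And>k. good (z k) (r k)" and bad: "\<And>k. \<not> good (z k) (r k / 2)"
      by metis
    have r_pos: "r k > 0" for k using r[of k] by linarith
    note zG = centralizer(1)[OF z]
    obtain C where C: "C > 0" "\<And>t. \<Phi> t \<le> 1 \<Longrightarrow> \<Phi> (2 * t) \<le> C * \<Phi> t"
      using Delta2_on_sublevel[OF Delta2] by blast
    define w where "w k x = b (z k) x / r k" for k x
    define s where "s k = (\<Sum>\<^sub>\<infinity>x\<in>carrier G. \<Phi> (w k x))" for k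
    have sum_w: "((\<lambda>x. \<Phi> (w k x)) has_sum s k) (carrier G)" and s_le: "s k \<le> 1" for k
      using good[of k] by (simp_all add: good_def s_def w_def)
    have w_le: "\<Phi> (w k x) \<le> 1" for k x
    proof (cases "x \<in> carrier G")
      case True
      then show ?thesis
        using finite_sum_le_has_sum[OF sum_w[of k], of "{x}"] s_le[of k] by simp
    next
      case False
      then show ?thesis
        using cocycle_in_space[OF b zG[of k]] by (simp add: w_def orlicz_space_iff)
    qed
    have w_double: "\<Phi> (2 * w k x) \<le> C * \<Phi> (w k x)" for k x
      by (rule C(2)[OF w_le])
    have s_lower: "1 / C \<le> s k" for k
    proof (rule ccontr)
      assume "\<not> 1 / C \<le> s k"
      then have "C * s k \<le> 1" using C(1) by (simp add: field_simps)
      moreover have "2 * w k x = b (z k) x / (r k / 2)" for x by (simp add: w_def)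
      ultimately have "good (z k) (r k / 2)"
        using infsum_le_dominated[OF has_sum_cmult_right[OF sum_w[of k], of C] nonneg w_double]
        unfolding good_def by auto
      with bad show False by blast
    qed
    have s_pos: "s k > 0" for k
      using s_lower[of k] C(1) by (meson divide_pos_pos less_le_trans zero_less_one)
    define P where "P k x = \<Phi> (w k x) / s k" for k x
    have "amenable (G\<lparr>carrier := N\<rparr>)"
    proof (rule Reiter_imp_amenable[OF group_axioms N(1), of P])
      show "0 \<le> P k x" for k x
        using s_pos[of k] by (simp add: P_def)
      have "(P k has_sum 1) (carrier G)" for k
        using has_sum_cmult_right[OF sum_w[of k], of "1 / s k"] s_pos[of k]
        by (simp add: P_def[abs_def])
      then show "P k summable_on carrier G" "infsum (P k) (carrier G) = 1" for k
        by (auto intro: has_sum_imp_summable infsumI)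
      fix n assume n: "n \<in> N"
      then have nG: "n \<in> carrier G" using subgroup.mem_carrier[OF N(1)] by blast
      define u where "u = b (inv n)"
      obtain R where R: "R > 0" "\<And>r. r \<ge> R \<Longrightarrow>
          (\<lambda>x. \<Phi> (u x / r)) summable_on carrier G \<and> (\<Sum>\<^sub>\<infinity>x\<in>carrier G. \<Phi> (u x / r)) \<le> 1"
        using orlicz_space_modular_le_1[OF cocycle_in_space[OF b inv_closed[OF nG]]]
        unfolding u_def by blast
      have displacement: "(\<Sum>\<^sub>\<infinity>x\<in>carrier G. \<bar>P k (n \<otimes> x) - P k x\<bar>) \<le> C * (\<epsilon> / 2 * (2 * C + 1))"
        if \<epsilon>: "0 < \<epsilon>" "\<epsilon> \<le> 1" and k: "4 * R / \<epsilon> \<le> r k" for \<epsilon> k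
      proof -
        (* The factor 4 absorbs two doublings: one from oscillation_le, one from splitting the
           difference of two translates of u. *)
        define \<rho> where "\<rho> = \<epsilon> * r k / 4"
        have \<rho>: "R \<le> \<rho>" using k \<epsilon> by (simp add: \<rho>_def field_simps)
        define c where "c = (\<Sum>\<^sub>\<infinity>x\<in>carrier G. \<Phi> (u x / \<rho>))"
        have sum_u: "((\<lambda>x. \<Phi> (u x / \<rho>)) has_sum c) (carrier G)" and c: "c \<le> 1"
          using R(2)[OF \<rho>] by (simp_all add: c_def)
        have sum_u_shift: "((\<lambda>x. \<Phi> (u (inv (z k) \<otimes> x) / \<rho>)) has_sum c) (carrier G)"
          using has_sum_reindex_bij_betw[OF translation_bij[OF inv_closed[OF zG[of k]]],
              of "\<lambda>x. \<Phi> (u x / \<rho>)"] sum_u by simp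
        have sum_w_shift: "((\<lambda>x. \<Phi> (w k (n \<otimes> x))) has_sum s k) (carrier G)"
          using has_sum_reindex_bij_betw[OF translation_bij[OF nG], of "\<lambda>x. \<Phi> (w k x)"] sum_w
          by simp
        define D where "D x = \<Phi> (w k (n \<otimes> x)) * C + \<Phi> (w k x) * C
            + (\<Phi> (u (inv (z k) \<otimes> x) / \<rho>) * (1 / 2) + \<Phi> (u x / \<rho>) * (1 / 2))" for x
        have "(D has_sum s k * C + s k * C + (c * (1 / 2) + c * (1 / 2))) (carrier G)"
          unfolding D_def
          by (intro has_sum_add has_sum_cmult_left sum_w sum_w_shift sum_u sum_u_shift)
        from has_sum_cmult_right[OF this, of "1 / s k * (\<epsilon> / 2)"]
        have sum_D: "((\<lambda>x. 1 / s k * (\<epsilon> / 2) * D x) has_sum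
            1 / s k * (\<epsilon> / 2) * (s k * C + s k * C + (c * (1 / 2) + c * (1 / 2)))) (carrier G)" .
        have le: "\<bar>P k (n \<otimes> x) - P k x\<bar> \<le> 1 / s k * (\<epsilon> / 2) * D x" if x: "x \<in> carrier G" for x
        proof -
          have "b (z k) (n \<otimes> x) - b (z k) x = u (inv (z k) \<otimes> x) - u x"
          proof -
            have "z k \<otimes> inv n = inv n \<otimes> z k"
              by (rule centralizer(2)[OF z subgroup.m_inv_closed[OF N(1) n]])
            from cocycle_commuting[OF b zG inv_closed[OF nG] this x] show ?thesis
              using nG by (simp add: u_def)
          qed
          then have "2 * ((w k (n \<otimes> x) - w k x) / \<epsilon>) = 2 * (u (inv (z k) \<otimes> x) - u x) / (\<epsilon> * r k)"
            using r_pos[of k] \<epsilon>(1) by (simp add: w_def diff_divide_distrib[symmetric] mult.commute)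
          also have "\<dots> = u (inv (z k) \<otimes> x) / \<rho> / 2 - u x / \<rho> / 2"
            using r_pos[of k] \<epsilon>(1) by (simp add: \<rho>_def field_simps)
          finally have "\<Phi> (2 * ((w k (n \<otimes> x) - w k x) / \<epsilon>))
              \<le> \<Phi> (u (inv (z k) \<otimes> x) / \<rho>) / 2 + \<Phi> (u x / \<rho>) / 2"
            using diff_le[of "u (inv (z k) \<otimes> x) / \<rho> / 2" "u x / \<rho> / 2"] by simp
          then have "\<Phi> (2 * w k (n \<otimes> x)) + \<Phi> (2 * w k x) + \<Phi> (2 * ((w k (n \<otimes> x) - w k x) / \<epsilon>)) \<le> D x"
            using w_double[of k "n \<otimes> x"] w_double[of k x] unfolding D_def
            by (simp add: mult.commute)
          then have "\<bar>\<Phi> (w k (n \<otimes> x)) - \<Phi> (w k x)\<bar> \<le> \<epsilon> / 2 * D x"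
            using \<epsilon> by (intro order.trans[OF oscillation_le[OF \<epsilon>]] mult_left_mono) auto
          from mult_left_mono[OF this, of "1 / s k"] show ?thesis
            using s_pos[of k] by (simp add: P_def diff_divide_distrib[symmetric] abs_div_pos[symmetric])
        qed
        have "(\<Sum>\<^sub>\<infinity>x\<in>carrier G. \<bar>P k (n \<otimes> x) - P k x\<bar>)
            \<le> 1 / s k * (\<epsilon> / 2) * (s k * C + s k * C + (c * (1 / 2) + c * (1 / 2)))"
          by (rule infsum_le_dominated(2)[OF sum_D _ le]) auto
        also have "\<dots> \<le> C * (\<epsilon> / 2) * (s k * C + s k * C + (c * (1 / 2) + c * (1 / 2)))"
        proof (intro mult_right_mono)
          show "1 / s k \<le> C"
            using s_lower[of k] s_pos[of k] C(1) by (simp add: field_simps)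
          have "c \<ge> 0" unfolding c_def by (rule infsum_nonneg) simp
          then show "0 \<le> s k * C + s k * C + (c * (1 / 2) + c * (1 / 2))"
            using s_pos[of k] C(1) by simp
        qed (use \<epsilon> in simp)
        also have "\<dots> \<le> C * (\<epsilon> / 2) * (1 * C + 1 * C + 1)"
          using s_le[of k] c C(1) \<epsilon>(1)
          by (intro mult_left_mono add_mono mult_right_mono) auto
        finally show ?thesis by (simp add: mult.assoc)
      qed
      show "(\<lambda>k. \<Sum>\<^sub>\<infinity>x\<in>carrier G. \<bar>P k (n \<otimes> x) - P k x\<bar>) \<longlonglongrightarrow> 0"
      proof (rule LIMSEQ_I)
        fix e :: real assume e: "0 < e"
        define \<epsilon> where "\<epsilon> = min 1 (e / (C * (2 * C + 1)))"
        have K: "C * (2 * C + 1) > 0" using C(1) by simp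
        have \<epsilon>: "0 < \<epsilon>" "\<epsilon> \<le> 1" using e K unfolding \<epsilon>_def by auto
        have "\<epsilon> \<le> e / (C * (2 * C + 1))"
          by (simp add: \<epsilon>_def)
        then have "\<epsilon> * (C * (2 * C + 1)) \<le> e"
          using K by (simp only: pos_le_divide_eq)
        moreover have "C * (\<epsilon> / 2 * (2 * C + 1)) = \<epsilon> * (C * (2 * C + 1)) / 2"
          by simp
        ultimately have less: "C * (\<epsilon> / 2 * (2 * C + 1)) < e"
          using e by linarith
        show "\<exists>k0. \<forall>k\<ge>k0. norm ((\<Sum>\<^sub>\<infinity>x\<in>carrier G. \<bar>P k (n \<otimes> x) - P k x\<bar>) - 0) < e"
        proof (intro exI allI impI)
          fix k assume "nat \<lceil>4 * R / \<epsilon>\<rceil> \<le> k"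
          then have "4 * R / \<epsilon> \<le> r k" using r[of k] by linarith
          from displacement[OF \<epsilon> this] less
          show "norm ((\<Sum>\<^sub>\<infinity>x\<in>carrier G. \<bar>P k (n \<otimes> x) - P k x\<bar>) - 0) < e"
            by (simp add: infsum_nonneg)
        qed
      qed
    qed
    with N(2) show False by blast
  qed
  then show thesis using that unfolding good_def by blast
qed

text \<open>Let \<open>z k\<close> run through distinct elements of the centralizer. The bounded family \<open>b (z k)\<close>
  has a pointwise cluster point \<open>y\<close>, which lies in the Orlicz space by Fatou's lemma. In
  \<open>(\<pi> n - 1) (b (z k)) = \<pi> (z k) (b n) - b n\<close> the first term on the right tends to \<open>0\<close> pointwise,
  because translates of a function vanishing at infinity escape. In the limit
  \<open>b n = y - \<pi> n y\<close>, and \<open>- y\<close> is the required vector.\<close>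

lemma coboundary_on_normal_subgroup:
  assumes Delta2: "Delta2_zero \<Phi>" and N: "subgroup N G" "\<not> amenable (G\<lparr>carrier := N\<rparr>)"
    and inf: "infinite (centralizer G N)" and b: "b \<in> Z1"
  obtains v where "v \<in> V" "\<And>n x. n \<in> N \<Longrightarrow> x \<in> carrier G \<Longrightarrow> b n x = v (inv n \<otimes> x) - v x"
proof -
  obtain r where r: "r > 0" and bound: "\<And>z. z \<in> centralizer G N \<Longrightarrow>
      (\<lambda>x. \<Phi> (b z x / r)) summable_on carrier G \<and> (\<Sum>\<^sub>\<infinity>x\<in>carrier G. \<Phi> (b z x / r)) \<le> 1"
    using cocycle_bounded_on_centralizer[OF Delta2 N b] by blast
  obtain z :: "nat \<Rightarrow> 'a" where inj: "inj z" and "range z \<subseteq> centralizer G N"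
    using infinite_countable_subset[OF inf] by blast
  then have z: "z k \<in> centralizer G N" for k by blast
  then have zG: "z k \<in> carrier G" for k by (simp add: centralizer_def)
  have outside: "b (z k) x = 0" if "x \<notin> carrier G" for k x
    using cocycle_in_space[OF b zG] that by (simp add: orlicz_space_iff)
  have finite_bound: "(\<Sum>x\<in>F. \<Phi> (b (z k) x / r)) \<le> 1" if "finite F" "F \<subseteq> carrier G" for F k
    using finite_sum_le_infsum[of "\<lambda>x. \<Phi> (b (z k) x / r)" "carrier G" F] bound[OF z[of k]] that by simp
  obtain M where M: "M > 0" "\<And>t. \<Phi> t \<le> 1 \<Longrightarrow> \<bar>t\<bar> \<le> M"
    using sublevel_bounded by blast
  have "\<bar>b (z k) x\<bar> \<le> M * r" for k x
  proof (cases "x \<in> carrier G")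
    case True
    then show ?thesis
      using M(2)[of "b (z k) x / r"] finite_bound[of "{x}" k] r by (simp add: field_simps)
  next
    case False
    then show ?thesis using outside[OF False, of k] M(1) r by simp
  qed
  then obtain y F where F: "F \<noteq> bot" "F \<le> sequentially"
    and lim: "\<And>x. ((\<lambda>k. b (z k) x) \<longlongrightarrow> y x) F"
    using bounded_sequence_subnet[of "\<lambda>k. b (z k)" "\<lambda>_. M * r"] by blast
  have "(\<lambda>x. \<Phi> (1 / r * y x)) summable_on carrier G"
  proof (rule nonneg_bdd_above_summable_on)
    show "bdd_above (sum (\<lambda>x. \<Phi> (1 / r * y x)) ` {A. A \<subseteq> carrier G \<and> finite A})"
    proof (rule bdd_aboveI2)
      fix A assume A: "A \<in> {A. A \<subseteq> carrier G \<and> finite A}"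
      have "((\<lambda>k. \<Sum>x\<in>A. \<Phi> (b (z k) x / r)) \<longlongrightarrow> (\<Sum>x\<in>A. \<Phi> (y x / r))) F"
        using r by (intro tendsto_sum isCont_tendsto_compose[OF continuous] tendsto_divide lim tendsto_const) simp
      then have "(\<Sum>x\<in>A. \<Phi> (y x / r)) \<le> 1"
        by (rule tendsto_upperbound[OF _ always_eventually F(1)]) (use A finite_bound in auto)
      then show "(\<Sum>x\<in>A. \<Phi> (1 / r * y x)) \<le> 1" by simp
    qed
  qed simp
  moreover have "y x = 0" if "x \<notin> carrier G" for x
    using tendsto_unique[OF F(1) lim[of x]] outside[OF that] by simp
  ultimately have "y \<in> V"
    unfolding orlicz_space_iff using r by (auto intro: exI[of _ "1 / r"])
  moreover have "b n x = y x - y (inv n \<otimes> x)" if n: "n \<in> N" and x: "x \<in> carrier G" for n x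
  proof -
    have nG: "n \<in> carrier G" using subgroup.mem_carrier[OF N(1) n] .
    have eq: "b n x = b n (inv (z k) \<otimes> x) - (b (z k) (inv n \<otimes> x) - b (z k) x)" for k
      using cocycle_commuting[OF b zG nG _ x, of k] z[of k] n by (simp add: centralizer_def)
    have "(\<lambda>k. b n (inv (z k) \<otimes> x)) \<longlonglongrightarrow> 0"
    proof (rule LIMSEQ_I)
      fix e :: real assume "0 < e"
      have "inj (\<lambda>k. inv (z k) \<otimes> x)"
        using inj x zG by (auto simp: inj_def dest!: inj_onD[OF inv_inj])
      then have "finite ((\<lambda>k. inv (z k) \<otimes> x) -` {t. e \<le> \<bar>b n t\<bar>})"
        by (intro finite_vimageI orlicz_space_finite_superlevel[OF cocycle_in_space[OF b nG] \<open>0 < e\<close>])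
      then obtain k0 where "\<forall>k\<in>(\<lambda>k. inv (z k) \<otimes> x) -` {t. e \<le> \<bar>b n t\<bar>}. k < k0"
        unfolding finite_nat_set_iff_bounded by blast
      then have "\<forall>k\<ge>k0. norm (b n (inv (z k) \<otimes> x) - 0) < e"
        by (auto simp: not_le[symmetric])
      then show "\<exists>k0. \<forall>k\<ge>k0. norm (b n (inv (z k) \<otimes> x) - 0) < e" ..
    qed
    then have "((\<lambda>k. b n (inv (z k) \<otimes> x)) \<longlongrightarrow> 0) F"
      by (rule filterlim_mono[OF _ order_refl F(2)])
    from tendsto_diff[OF this tendsto_diff[OF lim[of "inv n \<otimes> x"] lim[of x]]]
    have "((\<lambda>k. b n x) \<longlongrightarrow> 0 - (y (inv n \<otimes> x) - y x)) F"
      unfolding eq[symmetric] .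
    from tendsto_unique[OF F(1) this tendsto_const] show ?thesis by simp
  qed
  moreover have "(\<lambda>x. 0 - y x) \<in> V"
    by (rule orlicz_space_diff) (use \<open>y \<in> V\<close> in \<open>auto simp: orlicz_space_iff intro: exI[of _ 1]\<close>)
  ultimately show thesis
    using that[of "\<lambda>x. 0 - y x"] by simp
qed

lemma invariant_imp_zero:
  assumes "infinite N" and "N \<subseteq> carrier G" and f: "f \<in> V"
    and inv: "\<And>n x. n \<in> N \<Longrightarrow> x \<in> carrier G \<Longrightarrow> f (inv n \<otimes> x) = f x"
  shows "f x = 0"
proof (rule ccontr)
  assume nz: "f x \<noteq> 0"
  with f have x: "x \<in> carrier G" by (auto simp: orlicz_space_iff)
  have "inj_on (\<lambda>n. inv n \<otimes> x) N"
    using assms(2) x by (auto simp: inj_on_def subset_iff dest!: inj_onD[OF inv_inj])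
  with assms(1) have "infinite ((\<lambda>n. inv n \<otimes> x) ` N)"
    by (simp add: finite_image_iff)
  moreover have "(\<lambda>n. inv n \<otimes> x) ` N \<subseteq> {t. \<bar>f x\<bar> \<le> \<bar>f t\<bar>}"
    using inv x by auto
  moreover have "finite {t. \<bar>f x\<bar> \<le> \<bar>f t\<bar>}"
    by (rule orlicz_space_finite_superlevel[OF f]) (use nz in simp)
  ultimately show False using finite_subset by blast
qed

text \<open>Subtracting the coboundary of \<open>v\<close> leaves a cocycle \<open>c\<close> that vanishes on \<open>N\<close>. Then
  \<open>c (n \<otimes> g) = \<pi> n (c g)\<close>, while \<open>n \<otimes> g = g \<otimes> n'\<close> with \<open>n'\<close> in \<open>N\<close> gives \<open>c (n \<otimes> g) = c g\<close>.
  So \<open>c g\<close> is invariant under the infinite group \<open>N\<close>, hence zero.\<close>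

lemma coboundary_extends_from_normal_subgroup:
  assumes N: "N \<lhd> G" "infinite N" and b: "b \<in> Z1" and v: "v \<in> V"
    and on_N: "\<And>n x. n \<in> N \<Longrightarrow> x \<in> carrier G \<Longrightarrow> b n x = v (inv n \<otimes> x) - v x"
    and g: "g \<in> carrier G"
  shows "b g = left_regular G g v - v"
proof -
  interpret normal N G by fact
  have NG: "n \<in> carrier G" if "n \<in> N" for n using that by simp
  define c where "c h x = b h x - (left_regular G h v x - v x)" for h x
  have c_V: "c g \<in> V"
    unfolding c_def
    by (intro orlicz_space_diff cocycle_in_space[OF b g] left_regular_closed[OF g v] v)
  have c_mult: "c (h \<otimes> k) x = c h x + c k (inv h \<otimes> x)"
    if "h \<in> carrier G" "k \<in> carrier G" "x \<in> carrier G" for h k x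
    using that cocycle_mult_apply[OF b that]
    by (simp add: c_def left_regular_def inv_mult_group m_assoc)
  have c_N: "c n x = 0" if "n \<in> N" "x \<in> carrier G" for n x
    using on_N[OF that] that by (simp add: c_def left_regular_def)
  have c_inv: "c g (inv n \<otimes> x) = c g x" if n: "n \<in> N" and x: "x \<in> carrier G" for n x
  proof -
    define n' where "n' = inv g \<otimes> n \<otimes> g"
    have n': "n' \<in> N" unfolding n'_def by (rule inv_op_closed1[OF g n])
    have "g \<otimes> n' = n \<otimes> g"
      using g NG[OF n] by (simp add: n'_def m_assoc[symmetric])
    then show ?thesis
      using c_mult[OF NG[OF n] g x] c_mult[OF g NG[OF n'] x] c_N[OF n x] c_N[OF n', of "inv g \<otimes> x"] g x
      by simp
  qed
  have "c g x = 0" for x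
    by (rule invariant_imp_zero[OF N(2) subset c_V c_inv])
  then show ?thesis
    by (intro ext) (simp add: c_def)
qed

theorem cocycle_is_coboundary:
  assumes "Delta2_zero \<Phi>" and N: "N \<lhd> G" "infinite N" "\<not> amenable (G\<lparr>carrier := N\<rparr>)"
    and "infinite (centralizer G N)"
  shows "coboundaries G V (left_regular G) = Z1"
proof
  show "Z1 \<subseteq> coboundaries G V (left_regular G)"
  proof
    fix b assume b: "b \<in> Z1"
    obtain v where v: "v \<in> V" "\<And>n x. n \<in> N \<Longrightarrow> x \<in> carrier G \<Longrightarrow> b n x = v (inv n \<otimes> x) - v x"
      using coboundary_on_normal_subgroup[OF assms(1) normal_imp_subgroup[OF N(1)] N(3) assms(5) b] by blast
    then show "b \<in> coboundaries G V (left_regular G)"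
      using b coboundary_extends_from_normal_subgroup[OF N(1,2) b v] by (auto simp: coboundaries_def)
  qed
qed (auto simp: coboundaries_def)

lemma cocycle_group_comm: "comm_group (cocycle_group G V (left_regular G))"
proof (rule comm_groupI; simp add: cocycle_group_def)
  have zero_V: "0 \<in> V" by (auto simp: orlicz_space_iff intro: exI[of _ 1])
  show zero: "0 \<in> Z1"
    by (auto simp: cocycles_def left_regular_def zero_V fun_eq_iff)
  have diff: "(\<lambda>g x. b g x - c g x) \<in> Z1" if "b \<in> Z1" "c \<in> Z1" for b c
    using that by (auto simp: cocycles_def left_regular_def fun_eq_iff orlicz_space_diff)
  show "\<exists>c\<in>Z1. c + b = 0" if "b \<in> Z1" for b
    using diff[OF zero that] by (intro bexI[of _ "\<lambda>g x. 0 g x - b g x"]) (auto simp: fun_eq_iff)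
  show "b + c \<in> Z1" if "b \<in> Z1" "c \<in> Z1" for b c
    using diff[OF that(1) diff[OF zero that(2)]] by (simp add: plus_fun_def)
qed

end

section \<open>Vanishing of the reduced cohomology\<close>

lemma trivial_group_Mod_carrier:
  assumes "group H"
  shows "trivial_group (H Mod carrier H)"
proof -
  interpret group H by fact
  have "carrier H \<lhd> H" by (rule normal_self)
  then have "group (H Mod carrier H)" by (rule normal.factorgroup_is_group)
  moreover have "carrier (H Mod carrier H) \<subseteq> {\<one>\<^bsub>H Mod carrier H\<^esub>}"
    using coset_join2[OF _ subgroup_self] by (auto simp: FactGroup_def RCOSETS_def)
  ultimately show ?thesis
    using group.trivial_group_subset by blast
qed

text \<open>The empty set of test elements already gives the whole space of cocycles as a basic open set.\<close>

lemma topspace_cocycle_topology: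
  "topspace (cocycle_topology G W \<nu> \<pi>) = cocycles G W \<pi>"
proof -
  have "cocycles G W \<pi> \<subseteq> topspace (cocycle_topology G W \<nu> \<pi>)"
  proof
    fix b assume b: "b \<in> cocycles G W \<pi>"
    then have "{c \<in> cocycles G W \<pi>. \<forall>g\<in>{}. \<nu> (c g - b g) < 1} \<subseteq> topspace (cocycle_topology G W \<nu> \<pi>)"
      unfolding cocycle_topology_def topology_generated_by_topspace
      by (intro Union_upper CollectI exI[of _ b] exI[of _ "{}"] exI[of _ "1::real"]) auto
    with b show "b \<in> topspace (cocycle_topology G W \<nu> \<pi>)" by auto
  qed
  then show ?thesis
    by (auto simp: cocycle_topology_def)
qed

theorem theorem4p1:
  fixes G :: "('a, 'm) monoid_scheme" and N :: "'a set" and \<Phi> :: "real \<Rightarrow> real"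
  assumes "N_function \<Phi>" and "Delta2_zero \<Phi>" and "Nabla2_zero \<Phi>"
    and "group G" and "finitely_generated_group G"
    and "normal N G" and "infinite N" and "finitely_generated_group (G\<lparr>carrier := N\<rparr>)"
    and "\<not> amenable (G\<lparr>carrier := N\<rparr>)"
    and "infinite (centralizer G N)"
  shows "trivial_group (reduced_cohomology1 G (orlicz_space \<Phi> (carrier G))
           (gauge_norm \<Phi> (carrier G)) (left_regular G))"
proof -
  interpret orlicz_module \<Phi> G
    using N_function_imp_young_function[OF assms(1)] assms(4) by (rule orlicz_module.intro)
  let ?H = "cocycle_group G V (left_regular G)"
  let ?T = "cocycle_topology G V (gauge_norm \<Phi> (carrier G)) (left_regular G)"
  have "?T closure_of coboundaries G V (left_regular G) = carrier ?H"
    unfolding cocycle_is_coboundary[OF assms(2,6,7,9,10)]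
    using closure_of_topspace[of ?T] by (simp add: topspace_cocycle_topology cocycle_group_def)
  then have "reduced_cohomology1 G V (gauge_norm \<Phi> (carrier G)) (left_regular G) = ?H Mod carrier ?H"
    by (simp add: reduced_cohomology1_def)
  then show ?thesis
    using trivial_group_Mod_carrier[OF comm_group.axioms(2)[OF cocycle_group_comm]] by simp
qed

end
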